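(* Let $\mathbf P=(P,\leq,*,1)$ be a strongly sectionally pseudocomplemented poset and $F$ a subset of $P$ that is closed with respect to the following partial ideal terms: \begin{align*} T_1 & :=1, \\ T_2(x_1,x_2,x_3,y_1,y_2) & :=((U(x_1,x_2)\wedge(y_1*x_2)\wedge y_2)*x_3)*(x_2*x_3), \\ T_3(x_1,x_2,x_3,y_1,y_2) & :=(x_3*x_1)*(x_3*(U(x_1,x_2)\wedge(y_2*x_1)\wedge y_1)), \\ T_4(x_1,x_2,x_3,x_4,y_1,y_2,y_3,y_4) & :=((U(x_1,x_2)\wedge(y_1*x_2)\wedge y_2)\wedge(U(x_3,x_4)\wedge(y_3*x_4)\wedge y_4))*(x_2\wedge x_4). \end{align*} Then $F\in\operatorname{Fil}\mathbf P$.
   Context: For a poset $(P,\leq)$ and $A\subseteq P$, $U(A)$ and $L(A)$ denote the sets of all upper, respectively lower, bounds of $A$; $U(a,b)=U(\{a,b\})$, $L(b)=L(\{b\})$, $L(U(a,b),c)=L(U(a,b)\cup\{c\})$. The poset is sectionally pseudocomplemented if for all $a,b\in P$ there exists a greatest element $c$ of $P$ with $L(U(a,b),c)=L(b)$; this $c$ is denoted by $a*b$, and one writes $(P,\leq,* )$. A strongly sectionally pseudocomplemented poset is a quadruple $(P,\leq,*,1)$ such that $(P,\leq,* )$ is a sectionally pseudocomplemented poset with greatest element $1$ satisfying $x\leq(x*y)*y$ for all $x,y\in P$. A filter of $\mathbf P$ is a subset $F$ of $P$ containing $1$ such that for all $x,y,z,v\in P$: (1) if $x*y,y*x\in F$ then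 $(x*z)*(y*z),(z*x)*(z*y)\in F$; (2) if $x*y,y*x,z*v,v*z\in F$, $x$ and $z$ are comparable and $y$ and $v$ are comparable, then $\min(x,z)*\min(y,v)\in F$. $\operatorname{Fil}\mathbf P$ is the set of all filters of $\mathbf P$. The symbol $\wedge$ denotes the (partially defined) infimum in $(P,\leq)$: $a\wedge b=\inf(a,b)$, and $U(x,y)\wedge z\wedge u$ is the infimum of the set $U(x,y)\cup\{z,u\}$, when it exists. A partial ideal term is a partially defined term $T(x_1,\ldots,x_n,y_1,\ldots,y_m)$ in the language of sectionally pseudocomplemented posets with greatest element $1$ (including also the binary operator $U(x,y)$) satisfying $T(x_1,\ldots,x_n,1,\ldots,1)\approx1$. A subset $A\subseteq P$ is closed with respect to partial ideal terms $T_i(x_1,\ldots,x_n,y_1,\ldots,y_m)$, $i\in I$, if for every $i\in I$, all $x_1,\ldots,x_n\in P$ and all $y_1,\ldots,y_m\in A$, $T_i(x_1,\ldots,x_n,y_1,\ldots,y_m)$ is defined and belongs to $A$ (for $T_1$ this means $1\in A$). *)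

theory Defs
  imports "HOL-Algebra.Lattice"
begin

section \<open>Strongly sectionally pseudocomplemented posets\<close>

record 'a ssp_poset = "'a gorder" +
  star :: "['a, 'a] \<Rightarrow> 'a" (infixl "\<star>\<index>" 75)
  unit :: 'a ("\<one>\<index>")

locale sectionally_pseudocomplemented_poset = partial_order P for P (structure) +
  assumes star_greatest:
    "\<lbrakk>a \<in> carrier P; b \<in> carrier P\<rbrakk> \<Longrightarrow>
      greatest P (a \<star> b)
        {c \<in> carrier P. Lower P (Upper P {a, b} \<union> {c}) = Lower P {b}}"

locale strongly_sectionally_pseudocomplemented_poset =
    sectionally_pseudocomplemented_poset P for P (structure) +
  assumes unit_greatest: "greatest P \<one> (carrier P)"
    and strong: "\<lbrakk>x \<in> carrier P; y \<in> carrier P\<rbrakk> \<Longrightarrow> x \<sqsubseteq> (x \<star> y) \<star> y"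


section \<open>Filters\<close>

definition comparable :: "('a, 'm) gorder_scheme \<Rightarrow> 'a \<Rightarrow> 'a \<Rightarrow> bool" where
  "comparable P x y \<longleftrightarrow> x \<sqsubseteq>\<^bsub>P\<^esub> y \<or> y \<sqsubseteq>\<^bsub>P\<^esub> x"

text \<open>Only used for comparable \<open>x\<close> and \<open>y\<close>.\<close>
definition lesser :: "('a, 'm) gorder_scheme \<Rightarrow> 'a \<Rightarrow> 'a \<Rightarrow> 'a" where
  "lesser P x y = (if x \<sqsubseteq>\<^bsub>P\<^esub> y then x else y)"

definition Fil :: "('a, 'm) ssp_poset_scheme \<Rightarrow> 'a set set" where
  "Fil P = {F. F \<subseteq> carrier P \<and> \<one>\<^bsub>P\<^esub> \<in> F \<and>
    (\<forall>x \<in> carrier P. \<forall>y \<in> carrier P. \<forall>z \<in> carrier P.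
       x \<star>\<^bsub>P\<^esub> y \<in> F \<and> y \<star>\<^bsub>P\<^esub> x \<in> F \<longrightarrow>
       (x \<star>\<^bsub>P\<^esub> z) \<star>\<^bsub>P\<^esub> (y \<star>\<^bsub>P\<^esub> z) \<in> F \<and>
       (z \<star>\<^bsub>P\<^esub> x) \<star>\<^bsub>P\<^esub> (z \<star>\<^bsub>P\<^esub> y) \<in> F) \<and>
    (\<forall>x \<in> carrier P. \<forall>y \<in> carrier P. \<forall>z \<in> carrier P. \<forall>v \<in> carrier P.
       x \<star>\<^bsub>P\<^esub> y \<in> F \<and> y \<star>\<^bsub>P\<^esub> x \<in> F \<and> z \<star>\<^bsub>P\<^esub> v \<in> F \<and> v \<star>\<^bsub>P\<^esub> z \<in> F \<and>
       comparable P x z \<and> comparable P y v \<longrightarrow>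
       lesser P x z \<star>\<^bsub>P\<^esub> lesser P y v \<in> F)}"


section \<open>Partial terms\<close>

text \<open>
  Terms denote elements, set terms denote subsets: \<open>El t\<close> is the singleton of \<open>t\<close>, \<open>Up s t\<close> is
  the set \<open>U(s, t)\<close> of upper bounds, and \<open>InfOf S\<close> is the infimum of \<open>S\<close>. Thus
  \<open>U(s, t) \<and> u \<and> w\<close> is \<open>InfOf (Up s t \<uplus> El u \<uplus> El w)\<close>.
  \<open>Xv i\<close> and \<open>Yv j\<close> are the two sorts of variables of a partial ideal term.
\<close>
datatype trm =
    Xv nat
  | Yv nat
  | One
  | Star trm trm (infixl "\<^bold>\<star>" 75)
  | InfOf sterm
and sterm =
    El trm
  | Up trm trm
  | SUn sterm sterm (infixl "\<uplus>" 65)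

abbreviation Meet :: "trm \<Rightarrow> trm \<Rightarrow> trm" (infixl "\<^bold>\<and>" 70) where
  "s \<^bold>\<and> t \<equiv> InfOf (El s \<uplus> El t)"

text \<open>The value is \<open>None\<close> where the term is undefined, i.e. where some infimum does not exist.\<close>
primrec eval :: "('a, 'm) ssp_poset_scheme \<Rightarrow> (nat \<Rightarrow> 'a) \<Rightarrow> (nat \<Rightarrow> 'a) \<Rightarrow> trm \<Rightarrow> 'a option"
  and evals :: "('a, 'm) ssp_poset_scheme \<Rightarrow> (nat \<Rightarrow> 'a) \<Rightarrow> (nat \<Rightarrow> 'a) \<Rightarrow> sterm \<Rightarrow> 'a set option"
where
  "eval P x y (Xv i) = Some (x i)"
| "eval P x y (Yv j) = Some (y j)"
| "eval P x y One = Some \<one>\<^bsub>P\<^esub>"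
| "eval P x y (s \<^bold>\<star> t) =
     (case (eval P x y s, eval P x y t) of
        (Some a, Some b) \<Rightarrow> Some (a \<star>\<^bsub>P\<^esub> b) | _ \<Rightarrow> None)"
| "eval P x y (InfOf S) =
     (case evals P x y S of
        Some A \<Rightarrow> (if \<exists>i. is_glb P i A then Some (\<Sqinter>\<^bsub>P\<^esub>A) else None)
      | None \<Rightarrow> None)"
| "evals P x y (El t) = (case eval P x y t of Some a \<Rightarrow> Some {a} | None \<Rightarrow> None)"
| "evals P x y (Up s t) =
     (case (eval P x y s, eval P x y t) of
        (Some a, Some b) \<Rightarrow> Some (Upper P {a, b}) | _ \<Rightarrow> None)"
| "evals P x y (S \<uplus> T) =
     (case (evals P x y S, evals P x y T) of
        (Some A, Some B) \<Rightarrow> Some (A \<union> B) | _ \<Rightarrow> None)"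

primrec vars_within :: "nat \<Rightarrow> nat \<Rightarrow> trm \<Rightarrow> bool"
  and vars_within_s :: "nat \<Rightarrow> nat \<Rightarrow> sterm \<Rightarrow> bool"
where
  "vars_within n m (Xv i) \<longleftrightarrow> i \<in> {1..n}"
| "vars_within n m (Yv j) \<longleftrightarrow> j \<in> {1..m}"
| "vars_within n m One \<longleftrightarrow> True"
| "vars_within n m (s \<^bold>\<star> t) \<longleftrightarrow> vars_within n m s \<and> vars_within n m t"
| "vars_within n m (InfOf S) \<longleftrightarrow> vars_within_s n m S"
| "vars_within_s n m (El t) \<longleftrightarrow> vars_within n m t"
| "vars_within_s n m (Up s t) \<longleftrightarrow> vars_within n m s \<and> vars_within n m t"
| "vars_within_s n m (S \<uplus> T) \<longleftrightarrow> vars_within_s n m S \<and> vars_within_s n m T"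

text \<open>
  A triple \<open>(n, m, t)\<close> stands for the term \<open>t(x\<^sub>1, \<dots>, x\<^sub>n, y\<^sub>1, \<dots>, y\<^sub>m)\<close>. The identity
  \<open>t(x\<^sub>1, \<dots>, x\<^sub>n, 1, \<dots>, 1) \<approx> 1\<close> between partial terms is required wherever its left-hand
  side is defined.
\<close>
type_synonym ary_trm = "nat \<times> nat \<times> trm"

definition partial_ideal_term :: "('a, 'm) ssp_poset_scheme \<Rightarrow> ary_trm \<Rightarrow> bool" where
  "partial_ideal_term P = (\<lambda>(n, m, t). vars_within n m t \<and>
     (\<forall>x v. (\<forall>i \<in> {1..n}. x i \<in> carrier P) \<and> eval P x (\<lambda>_. \<one>\<^bsub>P\<^esub>) t = Some v \<longrightarrow> v = \<one>\<^bsub>P\<^esub>))"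

definition closed_wrt :: "('a, 'm) ssp_poset_scheme \<Rightarrow> 'a set \<Rightarrow> ary_trm set \<Rightarrow> bool" where
  "closed_wrt P A TT \<longleftrightarrow>
     (\<forall>(n, m, t) \<in> TT. \<forall>x y.
        (\<forall>i \<in> {1..n}. x i \<in> carrier P) \<and> (\<forall>j \<in> {1..m}. y j \<in> A) \<longrightarrow>
        (\<exists>v \<in> A. eval P x y t = Some v))"

definition T1 :: ary_trm where
  "T1 = (0, 0, One)"

definition T2 :: ary_trm where
  "T2 = (3, 2,
     (InfOf (Up (Xv 1) (Xv 2) \<uplus> El (Yv 1 \<^bold>\<star> Xv 2) \<uplus> El (Yv 2)) \<^bold>\<star> Xv 3) \<^bold>\<star> (Xv 2 \<^bold>\<star> Xv 3))"

definition T3 :: ary_trm where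
  "T3 = (3, 2,
     (Xv 3 \<^bold>\<star> Xv 1) \<^bold>\<star> (Xv 3 \<^bold>\<star> InfOf (Up (Xv 1) (Xv 2) \<uplus> El (Yv 2 \<^bold>\<star> Xv 1) \<uplus> El (Yv 1))))"

definition T4 :: ary_trm where
  "T4 = (4, 4,
     (InfOf (Up (Xv 1) (Xv 2) \<uplus> El (Yv 1 \<^bold>\<star> Xv 2) \<uplus> El (Yv 2)) \<^bold>\<and>
      InfOf (Up (Xv 3) (Xv 4) \<uplus> El (Yv 3 \<^bold>\<star> Xv 4) \<uplus> El (Yv 4))) \<^bold>\<star> (Xv 2 \<^bold>\<and> Xv 4))"

text \<open>The four terms are partial ideal terms of every strongly sectionally pseudocomplemented poset.\<close>

lemma (in partial_order) glb_unique: "greatest L i (Lower L A) \<Longrightarrow> \<Sqinter>A = i"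
  unfolding inf_def by (rule some_equality) (auto intro: greatest_unique)

context strongly_sectionally_pseudocomplemented_poset
begin

lemma star_closed: "a \<in> carrier P \<Longrightarrow> b \<in> carrier P \<Longrightarrow> a \<star> b \<in> carrier P"
  using star_greatest[of a b] by (auto simp: greatest_def)
lemma unit_closed: "\<one> \<in> carrier P" using unit_greatest by (auto simp: greatest_def)
lemma unit_top: "x \<in> carrier P \<Longrightarrow> x \<sqsubseteq> \<one>" using unit_greatest by (auto simp: greatest_def)

lemma Low_eq: "a \<in> carrier P \<Longrightarrow> b \<in> carrier P \<Longrightarrow> Lower P (insert (a \<star> b) (Upper P {a, b})) = Lower P {b}"
  using star_greatest[of a b] by (auto simp: greatest_def)

lemma le_star: assumes "a \<in> carrier P" "b \<in> carrier P" shows "b \<sqsubseteq> a \<star> b"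
proof -
  have "b \<in> Lower P {b}" using assms by (auto simp: Lower_def)
  then have "b \<in> Lower P (insert (a \<star> b) (Upper P {a, b}))" using Low_eq assms by simp
  then show ?thesis using star_closed[OF assms] by (auto simp: Lower_def)
qed

lemma star_self: assumes "a \<in> carrier P" shows "a \<star> a = \<one>"
proof -
  have "Lower P (Upper P {a, a} \<union> {\<one>}) = Lower P {a}"
  proof -
    have "Upper P {a, a} = Upper P {a}" by simp
    moreover have "Lower P (Upper P {a} \<union> {\<one>}) = Lower P {a}" (is "?l = ?r")
    proof
      have "a \<in> Upper P {a}" using assms by (simp add: Upper_def)
      then show "?l \<subseteq> ?r" using assms by (auto simp: Lower_def)
      show "?r \<subseteq> ?l"
      proof
        fix l assume "l \<in> ?r"
        then have l: "l \<in> carrier P" "l \<sqsubseteq> a" using assms by (auto simp: Lower_def)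
        have "l \<sqsubseteq> u" if "u \<in> Upper P {a}" for u
          using that l assms le_trans[of l a u] by (simp add: Upper_def)
        then show "l \<in> ?l" using l unit_top by (auto simp: Lower_def)
      qed
    qed
    ultimately show ?thesis by simp
  qed
  then have "\<one> \<sqsubseteq> a \<star> a" using star_greatest[OF assms assms] unit_closed by (auto simp: greatest_def)
  then show ?thesis using unit_top star_closed unit_closed assms by (meson le_antisym)
qed

lemma T1_partial_ideal_term: "partial_ideal_term P T1"
  by (simp add: partial_ideal_term_def T1_def)

lemma glb_unit: assumes "x \<in> carrier P" "y \<in> carrier P"
  shows "greatest P y (Lower P (insert \<one> (insert (\<one> \<star> y) (Upper P {x, y}))))"
proof -
  have "\<one> \<star> y = y"
  proof -
    have "\<one> \<star> y \<in> Lower P (insert (\<one> \<star> y) (Upper P {\<one>, y}))"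
    proof -
      have "u = \<one>" if "u \<in> Upper P {\<one>, y}" for u
        using that unit_closed unit_top[of u] le_antisym[of u \<one>] by (simp add: Upper_def)
      then have "\<one> \<star> y \<sqsubseteq> u" if "u \<in> Upper P {\<one>, y}" for u
        using that star_closed[OF unit_closed assms(2)] unit_top by metis
      then show ?thesis using star_closed[OF unit_closed assms(2)]
        by (auto simp: Lower_def)
    qed
    then have "\<one> \<star> y \<sqsubseteq> y" using Low_eq unit_closed assms by (auto simp: Lower_def)
    then show ?thesis using le_star star_closed unit_closed assms by (meson le_antisym)
  qed
  then show ?thesis using assms unit_closed unit_top[OF assms(2)]
    by (simp add: greatest_def Lower_def Upper_def)
qed

lemma T2_partial_ideal_term: "partial_ideal_term P T2"
proof -
  have "v = \<one>" if x: "\<forall>i \<in> {1..3}. x i \<in> carrier P"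
    and v: "eval P x (\<lambda>_. \<one>) (snd (snd T2)) = Some v" for x v
  proof -
    have c: "x 1 \<in> carrier P" "x 2 \<in> carrier P" "x 3 \<in> carrier P" using x by auto
    note g = glb_unit[OF c(1,2)]
    show ?thesis using v g glb_unique[OF g] star_self[OF star_closed[OF c(2,3)]]
      by (simp add: T2_def split: if_splits)
  qed
  then show ?thesis by (simp add: partial_ideal_term_def T2_def)
qed

lemma T3_partial_ideal_term: "partial_ideal_term P T3"
proof -
  have "v = \<one>" if x: "\<forall>i \<in> {1..3}. x i \<in> carrier P"
    and v: "eval P x (\<lambda>_. \<one>) (snd (snd T3)) = Some v" for x v
  proof -
    have c: "x 1 \<in> carrier P" "x 2 \<in> carrier P" "x 3 \<in> carrier P" using x by auto
    note g = glb_unit[OF c(2,1), unfolded insert_commute[of "x 2" "x 1"]]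
    show ?thesis using v g glb_unique[OF g] star_self[OF star_closed[OF c(3,1)]]
      by (simp add: T3_def split: if_splits)
  qed
  then show ?thesis by (simp add: partial_ideal_term_def T3_def)
qed

lemma T4_partial_ideal_term: "partial_ideal_term P T4"
proof -
  have "v = \<one>" if x: "\<forall>i \<in> {1..4}. x i \<in> carrier P"
    and v: "eval P x (\<lambda>_. \<one>) (snd (snd T4)) = Some v" for x v
  proof -
    have c: "x 1 \<in> carrier P" "x 2 \<in> carrier P" "x 3 \<in> carrier P" "x 4 \<in> carrier P"
      using x by auto
    note g = glb_unit[OF c(1,2)] glb_unit[OF c(3,4)]
    have e: "\<exists>i. is_glb P i {x 4, x 2}" and v': "v = \<Sqinter>{x 4, x 2} \<star> \<Sqinter>{x 4, x 2}"
      using v g g[THEN glb_unique] by (auto simp: T4_def split: if_splits)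
    then have "\<Sqinter>{x 4, x 2} \<in> carrier P"
      using glb_unique by (auto simp: greatest_def Lower_def)
    then show ?thesis using v' star_self by simp
  qed
  then show ?thesis by (simp add: partial_ideal_term_def T4_def)
qed

end

end

(*
  If x and y satisfy x * y, y * x \<in> F, then x is recovered from y and these two elements of F as
  x = U(x,y) \<and> ((x * y) * y) \<and> (y * x): strongness makes x a lower bound, and any lower bound of
  U(x,y) and y * x lies below x by the definition of y * x.  Substituting this into T2, T3 and T4
  turns closedness of F into the filter conditions.
*)
theory Submission
  imports Defs
begin

context strongly_sectionally_pseudocomplemented_poset
begin

lemma glb_star:
  assumes "x \<in> carrier P" "y \<in> carrier P"
  shows "greatest P x (Lower P (insert (y \<star> x) (insert ((x \<star> y) \<star> y) (Upper P {x, y}))))"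
    (is "greatest P x (Lower P ?A)")
proof -
  have "?A \<subseteq> carrier P" using assms star_closed by (auto simp: Upper_def)
  moreover have "x \<in> Lower P ?A"
    using assms le_star strong by (auto simp: Lower_def Upper_def)
  moreover have "l \<sqsubseteq> x" if "l \<in> Lower P ?A" for l
  proof -
    \<comment> \<open>Dropping the bound \<open>(x \<star> y) \<star> y\<close> only enlarges the
      set of lower bounds; the pair is swapped to \<open>{y, x}\<close> because
      \<open>Low_eq\<close> is applied to \<open>y \<star> x\<close>.\<close>
    have "l \<in> Lower P (insert (y \<star> x) (Upper P {y, x}))"
      using that by (auto simp: Lower_def insert_commute)
    then have "l \<in> Lower P {x}" using Low_eq assms by simp
    then show ?thesis using assms by (auto simp: Lower_def)
  qed
  ultimately show ?thesis by (auto simp: greatest_def Lower_def)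
qed

text \<open>Evaluates the two meets of T4 that join its halves. The order \<open>{y, x}\<close> is
  the form to which simp brings the set under \<open>Meet\<close>.\<close>

lemma glb_lesser:
  assumes "comparable P x y" "x \<in> carrier P" "y \<in> carrier P"
  shows "greatest P (lesser P x y) (Lower P {y, x})"
  using assms by (auto simp: greatest_def Lower_def lesser_def comparable_def)

end

theorem theorem4p13:
  fixes P :: "('a, 'm) ssp_poset_scheme" and F :: "'a set"
  assumes "strongly_sectionally_pseudocomplemented_poset P"
    and "F \<subseteq> carrier P"
    and "closed_wrt P F {T1, T2, T3, T4}"
  shows "F \<in> Fil P"
proof -
  interpret strongly_sectionally_pseudocomplemented_poset P by fact
  have closed: "\<exists>v \<in> F. eval P x y t = Some v"
    if "(n, m, t) \<in> {T1, T2, T3, T4}" "\<forall>i \<in> {1..n}. x i \<in> carrier P" "\<forall>j \<in> {1..m}. y j \<in> F"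
    for n m t x y
    using assms(3) that unfolding closed_wrt_def by blast
  have "\<one>\<^bsub>P\<^esub> \<in> F"
    using closed[of 0 0 One] by (simp add: T1_def)
  moreover have "(x \<star>\<^bsub>P\<^esub> z) \<star>\<^bsub>P\<^esub> (y \<star>\<^bsub>P\<^esub> z) \<in> F"
    if c: "x \<in> carrier P" "y \<in> carrier P" "z \<in> carrier P"
      and F: "x \<star>\<^bsub>P\<^esub> y \<in> F" "y \<star>\<^bsub>P\<^esub> x \<in> F" for x y z
  proof -
    \<comment> \<open>The default values serve as the last variables: \<open>z\<close> is x3 and
      \<open>y \<star> x\<close> is y2. The infimum in T2 is then that of \<open>glb_star\<close>,
      namely \<open>x\<close>.\<close>
    let ?x = "(\<lambda>_. z)(1 := x, 2 := y)" and ?y = "(\<lambda>_. y \<star>\<^bsub>P\<^esub> x)(1 := x \<star>\<^bsub>P\<^esub> y)"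
    note g = glb_star[OF c(1,2)]
    have "\<exists>v \<in> F. eval P ?x ?y (snd (snd T2)) = Some v"
      using c F by (intro closed[of 3 2]) (auto simp: T2_def)
    then show ?thesis using g glb_unique[OF g] by (auto simp: T2_def split: if_splits)
  qed
  moreover have "(z \<star>\<^bsub>P\<^esub> x) \<star>\<^bsub>P\<^esub> (z \<star>\<^bsub>P\<^esub> y) \<in> F"
    if c: "x \<in> carrier P" "y \<in> carrier P" "z \<in> carrier P"
      and F: "x \<star>\<^bsub>P\<^esub> y \<in> F" "y \<star>\<^bsub>P\<^esub> x \<in> F" for x y z
  proof -
    let ?x = "(\<lambda>_. z)(1 := x, 2 := y)" and ?y = "(\<lambda>_. y \<star>\<^bsub>P\<^esub> x)(1 := x \<star>\<^bsub>P\<^esub> y)"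
    \<comment> \<open>T3 has the mirrored infimum, with \<open>(y \<star> x) \<star> x\<close> and
      \<open>x \<star> y\<close> as bounds, so \<open>glb_star\<close> with exchanged arguments
      yields \<open>y\<close> here.\<close>
    note g = glb_star[OF c(2,1), unfolded insert_commute[of y x]]
    have "\<exists>v \<in> F. eval P ?x ?y (snd (snd T3)) = Some v"
      using c F by (intro closed[of 3 2]) (auto simp: T3_def)
    then show ?thesis using g glb_unique[OF g] by (auto simp: T3_def split: if_splits)
  qed
  moreover have "lesser P x z \<star>\<^bsub>P\<^esub> lesser P y v \<in> F"
    if c: "x \<in> carrier P" "y \<in> carrier P" "z \<in> carrier P" "v \<in> carrier P"
      and F: "x \<star>\<^bsub>P\<^esub> y \<in> F" "y \<star>\<^bsub>P\<^esub> x \<in> F" "z \<star>\<^bsub>P\<^esub> v \<in> F" "v \<star>\<^bsub>P\<^esub> z \<in> F"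
      and comp: "comparable P x z" "comparable P y v" for x y z v
  proof -
    \<comment> \<open>Again the defaults fill the last slots, x4 and y4. The two inner infima become
      \<open>x\<close> and \<open>z\<close>; comparability then turns the outer meets into
      \<open>lesser P x z\<close> and \<open>lesser P y v\<close>.\<close>
    let ?x = "(\<lambda>_. v)(1 := x, 2 := y, 3 := z)"
      and ?y = "(\<lambda>_. v \<star>\<^bsub>P\<^esub> z)(1 := x \<star>\<^bsub>P\<^esub> y, 2 := y \<star>\<^bsub>P\<^esub> x, 3 := z \<star>\<^bsub>P\<^esub> v)"
    note g = glb_star[OF c(1,2)] glb_star[OF c(3,4)]
      glb_lesser[OF comp(1) c(1,3)] glb_lesser[OF comp(2) c(2,4)]
    have "\<exists>v \<in> F. eval P ?x ?y (snd (snd T4)) = Some v"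
      using c F by (intro closed[of 4 4]) (auto simp: T4_def)
    then show ?thesis
      using g g[THEN glb_unique] by (auto simp: T4_def split: if_splits)
  qed
  ultimately show ?thesis using assms(2) unfolding Fil_def by blast
qed

end
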